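(* Let $k$ be a positive integer, let $\lambda>1$, and let $K_n>0$ satisfy $K_n=K_{n+k}$ for $n=0,1,2,\dots$. Then there exists a $k$-periodic solution $x_n^*$ (that is, $x_n^*=x_{n+k}^*$) of the delayed Beverton-Holt equation $$x_{n+1}=\frac{\lambda x_n}{1+(\lambda-1)\frac{x_{n-1}}{K_n}},\quad n=0,1,2,\dots,$$ which is globally attractive, that is, for any solution $x_n$ of this equation, $$\lim_{n\to+\infty}(x_n-x_n^* )=0.$$
   Context: A solution of the equation means a sequence $(x_n)_{n\ge -1}$ satisfying it with initial conditions $x_0=x^0>0$ and $x_{-1}=x^{-1}\ge 0$. *)

theory Defs
  imports Complex_Main
begin

text \<open>A sequence $(x_n)_{n \ge -1}$ is represented by a function on the integers of which only the
  values at arguments \<open>\<ge> -1\<close> are relevant; the capacities $K_n$ are indexed by $n = 0, 1, 2, \dots$.\<close>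

definition delayed_BH_solution :: "real \<Rightarrow> (nat \<Rightarrow> real) \<Rightarrow> (int \<Rightarrow> real) \<Rightarrow> bool" where
  "delayed_BH_solution lam K x \<longleftrightarrow>
     x 0 > 0 \<and> x (-1) \<ge> 0 \<and>
     (\<forall>n::nat. x (int n + 1) = lam * x (int n) / (1 + (lam - 1) * (x (int n - 1) / K n)))"

end

theory Submission
  imports Defs
begin

text \<open>Why the theorem holds. Write \<open>u\<close> for the difference of the logarithms of two positive
  solutions. The mean value theorem, applied on the logarithmic scale to the denominators, gives
  \<open>u (n + 2) = u (n + 1) - a n * u n\<close> where \<open>a n\<close> is a value of the logistic function
  \<open>c * exp s / (1 + c * exp s)\<close> and so lies strictly between 0 and 1. For every coefficient in
  \<open>[0, 1]\<close> the linear map \<open>(u, v) \<mapsto> (v, v - a * u)\<close> sends the hexagon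
  \<open>\<bar>u\<bar> \<le> W, \<bar>v\<bar> \<le> W, \<bar>v - u\<bar> \<le> W\<close> into itself; when the coefficients keep a distance
  \<open>d\<close> from 0 and 1, three steps shrink it by the factor \<open>1 - d\<^sup>2\<close> (\<open>hexagon_contraction\<close>).
  The coefficients do keep such a distance, because every solution stays between two
  positive bounds (\<open>orbit_permanent\<close>). Hence any two solutions merge, at a rate determined by
  common bounds for them and for the coefficients \<open>c\<close> (\<open>orbits_merge_uniformly\<close>).

  Existence of the periodic solution follows from this uniform rate. The shift of a solution by a
  multiple of \<open>k\<close> satisfies the same recurrence with the same bounds, so comparing a solution
  with its shifts shows that it is a Cauchy sequence along each residue class modulo \<open>k\<close>. The
  limits form a \<open>k\<close>-periodic solution, and all solutions merge with it.\<close>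

section \<open>A linear second-order recurrence\<close>

text \<open>Two identities drive the contraction: the slope \<open>u (j + 2) - u (j + 1)\<close> equals
  \<open>- a j * u j\<close>, and \<open>u (j + 2)\<close> is the convex combination of \<open>u (j + 1)\<close> and
  \<open>u (j + 1) - u j\<close> with weights \<open>1 - a j\<close> and \<open>a j\<close>. A slope is thus reduced at once because the
  coefficient is at most \<open>1 - d\<close>, and a value is reduced one step later because the
  reduced slope enters it with a weight of at least \<open>d\<close>. The three bounds in the hypothesis
  and in the conclusion describe the same hexagon in the plane of consecutive values.\<close>

lemma hexagon_contraction:
  fixes u a :: "nat \<Rightarrow> real"
  assumes rec: "\<And>n. u (n + 2) = u (n + 1) - a n * u n"
    and d: "0 < d" "\<And>n. d \<le> a n" "\<And>n. a n \<le> 1 - d"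
    and W: "\<bar>u n\<bar> \<le> W" "\<bar>u (n + 1)\<bar> \<le> W" "\<bar>u (n + 1) - u n\<bar> \<le> W"
  shows "\<bar>u (n + 3)\<bar> \<le> (1 - d\<^sup>2) * W" "\<bar>u (n + 4)\<bar> \<le> (1 - d\<^sup>2) * W"
    "\<bar>u (n + 4) - u (n + 3)\<bar> \<le> (1 - d\<^sup>2) * W"
proof -
  have W0: "W \<ge> 0" using W(1) by linarith
  have d1: "d < 1" using d(1) d(2)[of 0] d(3)[of 0] by linarith
  have a01: "0 \<le> a j" "a j \<le> 1" for j using d(1) d(2)[of j] d(3)[of j] by linarith+
  have value_step: "\<bar>u (j + 2)\<bar> \<le> (1 - a j) * B + a j * S"
    if "\<bar>u (j + 1)\<bar> \<le> B" "\<bar>u (j + 1) - u j\<bar> \<le> S" for j B S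
  proof -
    have "u (j + 2) = (1 - a j) * u (j + 1) + a j * (u (j + 1) - u j)"
      unfolding rec by (simp add: algebra_simps)
    also have "\<bar>\<dots>\<bar> \<le> \<bar>(1 - a j) * u (j + 1)\<bar> + \<bar>a j * (u (j + 1) - u j)\<bar>"
      by (rule abs_triangle_ineq)
    also have "\<dots> \<le> (1 - a j) * B + a j * S"
      using that a01[of j] by (intro add_mono) (auto simp: abs_mult intro!: mult_left_mono)
    finally show ?thesis .
  qed
  have slope_step: "\<bar>u (j + 2) - u (j + 1)\<bar> \<le> (1 - d) * B" if "\<bar>u j\<bar> \<le> B" for j B
  proof -
    have "\<bar>u (j + 2) - u (j + 1)\<bar> = a j * \<bar>u j\<bar>"
      unfolding rec using a01[of j] by (simp add: abs_mult)
    also have "\<dots> \<le> (1 - d) * B"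
      using that d(3)[of j] a01[of j] d1 by (intro mult_mono) auto
    finally show ?thesis .
  qed
  have mix: "(1 - a j) * W + a j * ((1 - d) * W) \<le> (1 - d\<^sup>2) * W" for j
  proof -
    have "d * (d * W) \<le> a j * (d * W)" using d W0 by (intro mult_right_mono) auto
    then show ?thesis by (simp add: algebra_simps power2_eq_square)
  qed
  have "(1 - a n) * W + a n * W = W" by (simp add: algebra_simps)
  then have v2: "\<bar>u (n + 2)\<bar> \<le> W" using value_step[OF W(2,3)] by simp
  have s2: "\<bar>u (n + 2) - u (n + 1)\<bar> \<le> (1 - d) * W" by (rule slope_step[OF W(1)])
  have s3: "\<bar>u (n + 3) - u (n + 2)\<bar> \<le> (1 - d) * W"
    using slope_step[of "n + 1" W] W(2) by (simp add: numeral_3_eq_3)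
  show v3: "\<bar>u (n + 3)\<bar> \<le> (1 - d\<^sup>2) * W"
    using value_step[of "n + 1" W "(1 - d) * W"] v2 s2 mix[of "n + 1"]
    by (simp add: numeral_3_eq_3)
  have q: "(1 - d\<^sup>2) * W \<le> W" "(1 - d) * W \<le> (1 - d\<^sup>2) * W"
  proof -
    have "d * d \<le> d" using d(1) d1 by (simp add: mult_left_le_one_le)
    then have "1 - d\<^sup>2 \<le> 1" "1 - d \<le> 1 - d\<^sup>2" by (auto simp: power2_eq_square)
    then show "(1 - d\<^sup>2) * W \<le> W" "(1 - d) * W \<le> (1 - d\<^sup>2) * W"
      using W0 mult_right_mono[of "1 - d\<^sup>2" 1 W] by (auto intro: mult_right_mono)
  qed
  show "\<bar>u (n + 4)\<bar> \<le> (1 - d\<^sup>2) * W"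
    using value_step[of "n + 2" W "(1 - d) * W"] v3 s3 q(1) mix[of "n + 2"]
    by (simp add: eval_nat_numeral)
  show "\<bar>u (n + 4) - u (n + 3)\<bar> \<le> (1 - d\<^sup>2) * W"
    using slope_step[of "n + 2" W] v2 q(2) by (simp add: eval_nat_numeral)
qed

lemma linear_recurrence_geometric_decay:
  fixes u a :: "nat \<Rightarrow> real"
  assumes rec: "\<And>n. u (n + 2) = u (n + 1) - a n * u n"
    and d: "0 < d" "\<And>n. d \<le> a n" "\<And>n. a n \<le> 1 - d"
    and W: "\<bar>u 0\<bar> \<le> W" "\<bar>u 1\<bar> \<le> W" "\<bar>u 1 - u 0\<bar> \<le> W"
    and r: "r < 3"
  shows "\<bar>u (3 * i + r)\<bar> \<le> (1 - d\<^sup>2) ^ i * (2 * W)"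
proof -
  let ?q = "1 - d\<^sup>2"
  have W0: "W \<ge> 0" using W(1) by linarith
  have d1: "d < 1" using d(1) d(2)[of 0] d(3)[of 0] by linarith
  then have q: "0 \<le> ?q" using d(1) by (simp add: power_le_one)
  have V: "\<bar>u (3 * i)\<bar> \<le> ?q ^ i * W \<and> \<bar>u (3 * i + 1)\<bar> \<le> ?q ^ i * W \<and>
           \<bar>u (3 * i + 1) - u (3 * i)\<bar> \<le> ?q ^ i * W" for i
  proof (induction i)
    case 0
    then show ?case using W by simp
  next
    case (Suc i)
    then show ?case
      using hexagon_contraction[OF rec d, of "3 * i" "?q ^ i * W"]
      by (simp add: algebra_simps)
  qed
  \<comment> \<open>the hexagon at \<open>3 * i\<close> covers only two of the three indices; one crude step, which costs the
    factor 2 in the result, reaches the third\<close>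
  have "\<bar>u (3 * i + 2)\<bar> \<le> \<bar>u (3 * i + 1)\<bar> + a (3 * i) * \<bar>u (3 * i)\<bar>"
    unfolding rec using abs_triangle_ineq4[of "u (3 * i + 1)" "a (3 * i) * u (3 * i)"] d(1) d(2)[of "3 * i"]
    by (simp add: abs_mult)
  also have "\<dots> \<le> ?q ^ i * W + 1 * (?q ^ i * W)"
    using V[of i] d(1) d(2)[of "3 * i"] d(3)[of "3 * i"] by (intro add_mono mult_mono) auto
  finally have V2: "\<bar>u (3 * i + 2)\<bar> \<le> ?q ^ i * (2 * W)" by linarith
  have "?q ^ i * W \<le> ?q ^ i * (2 * W)" using q W0 by (intro mult_left_mono) auto
  then have V01: "\<bar>u (3 * i + 0)\<bar> \<le> ?q ^ i * (2 * W)" "\<bar>u (3 * i + 1)\<bar> \<le> ?q ^ i * (2 * W)"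
    using V[of i] by auto
  consider "r = 0" | "r = 1" | "r = 2" using r by linarith
  then show ?thesis by cases (use V01 V2 in blast)+
qed

section \<open>Contraction between solutions\<close>

text \<open>In the variable \<open>ln x\<close> the function \<open>ln (1 + c * x)\<close> has slope \<open>c * x / (1 + c * x)\<close>, which
  increases with \<open>x\<close>; its values at \<open>m\<close> and \<open>M\<close> bound the slope of every secant.\<close>

lemma ln_one_plus_mean_value:
  fixes c m M x y :: real
  assumes "c > 0" "m > 0" "m \<le> x" "x \<le> M" "m \<le> y" "y \<le> M"
  shows "\<exists>a. c * m / (1 + c * m) \<le> a \<and> a \<le> c * M / (1 + c * M) \<and>
             ln (1 + c * x) - ln (1 + c * y) = a * (ln x - ln y)"
proof -
  have M: "M > 0" using assms by linarith
  have mono: "c * s / (1 + c * s) \<le> c * t / (1 + c * t)" if "0 < s" "s \<le> t" for s t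
  proof -
    have "0 < 1 + c * s" "0 < 1 + c * t" using that assms(1) by (auto intro!: add_pos_pos)
    then show ?thesis using that assms(1) by (simp add: divide_simps) (simp add: algebra_simps)
  qed
  let ?P = "\<lambda>x y. \<exists>a. c * m / (1 + c * m) \<le> a \<and> a \<le> c * M / (1 + c * M) \<and>
             ln (1 + c * x) - ln (1 + c * y) = a * (ln x - ln y)"
  have lt: "?P x y" if "m \<le> y" "y < x" "x \<le> M" for x y
  proof -
    have pos: "0 < y" "0 < x" using that assms by linarith+
    have "ln y < ln x" using that pos by simp
    then obtain z where z: "ln y < z" "z < ln x"
      and eq: "ln (1 + c * exp (ln x)) - ln (1 + c * exp (ln y))
                = (ln x - ln y) * (c * exp z / (1 + c * exp z))"
    proof (rule MVT2[where f = "\<lambda>s. ln (1 + c * exp s)" and f' = "\<lambda>s. c * exp s / (1 + c * exp s)",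
        THEN exE])
      show "DERIV (\<lambda>s. ln (1 + c * exp s)) s :> c * exp s / (1 + c * exp s)" for s
        using assms(1) by (auto intro!: derivative_eq_intros add_pos_pos)
    qed auto
    have "m \<le> exp z" "exp z \<le> M"
      using z pos that by (metis exp_ln exp_less_mono less_imp_le order_trans)+
    then show ?thesis
      using eq pos mono[of m "exp z"] mono[of "exp z" M] assms(2)
      by (intro exI[of _ "c * exp z / (1 + c * exp z)"]) (auto simp: mult.commute)
  qed
  consider "x = y" | "y < x" | "x < y" by linarith
  then show ?thesis
  proof cases
    case 1
    then show ?thesis using mono[of m M] assms by auto
  next
    case 2
    then show ?thesis using lt assms by blast
  next
    case 3
    then obtain a where "c * m / (1 + c * m) \<le> a" "a \<le> c * M / (1 + c * M)"
      "ln (1 + c * y) - ln (1 + c * x) = a * (ln y - ln x)" using lt[of x y] assms by blast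
    then show ?thesis by (intro exI[of _ a]) (auto simp: algebra_simps)
  qed
qed

lemma abs_diff_le_abs_ln_diff:
  fixes x y M :: real
  assumes "0 < x" "x \<le> M" "0 < y" "y \<le> M"
  shows "\<bar>x - y\<bar> \<le> M * \<bar>ln x - ln y\<bar>"
proof -
  have *: "s - t \<le> M * \<bar>ln s - ln t\<bar>" if "0 < s" "s \<le> M" "0 < t" for s t
  proof -
    have "ln t - ln s \<le> (t - s) / s" using that by (intro ln_diff_le) auto
    then have "s - t \<le> s * (ln s - ln t)" using that by (simp add: field_simps)
    also have "\<dots> \<le> s * \<bar>ln s - ln t\<bar>" using that by (intro mult_left_mono) auto
    also have "\<dots> \<le> M * \<bar>ln s - ln t\<bar>" using that by (intro mult_right_mono) auto
    finally show ?thesis .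
  qed
  show ?thesis using *[of x y] *[of y x] assms by (simp add: abs_le_iff abs_minus_commute)
qed

text \<open>The recurrence in terms of \<open>c n = (lam - 1) / K (n + 1)\<close>. Starting at \<open>x 0\<close> leaves out
  \<open>x (-1)\<close>, which may vanish and then has no logarithm.\<close>

definition orbit_within :: "real \<Rightarrow> (nat \<Rightarrow> real) \<Rightarrow> real \<Rightarrow> real \<Rightarrow> (nat \<Rightarrow> real) \<Rightarrow> bool" where
  "orbit_within lam c m M x \<longleftrightarrow>
     (\<forall>n. m \<le> x n \<and> x n \<le> M \<and> x (n + 2) = lam * x (n + 1) / (1 + c n * x n))"

text \<open>The rate \<open>\<rho>\<close> is the same for all pairs of orbits between \<open>m\<close> and \<open>M\<close>: the coefficients
  of the linear recurrence for the logarithmic difference are controlled by the bounds alone, and so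
  is the initial hexagon. This uniformity is what yields Cauchy sequences from shifted orbits.\<close>

lemma orbits_merge_uniformly:
  fixes c :: "nat \<Rightarrow> real"
  assumes lam: "lam > 0" and m: "m > 0"
    and c: "0 < c1" "\<And>n. c1 \<le> c n" "\<And>n. c n \<le> c2"
  shows "\<exists>\<rho> :: nat \<Rightarrow> real. \<rho> \<longlonglongrightarrow> 0 \<and>
           (\<forall>x y n. orbit_within lam c m M x \<longrightarrow> orbit_within lam c m M y \<longrightarrow> \<bar>x n - y n\<bar> \<le> \<rho> n)"
proof (cases "m \<le> M")
  case False
  then show ?thesis by (auto simp: orbit_within_def intro!: exI[of _ "\<lambda>_. 0"])
next
  case mM: True
  have c2: "0 < c2" using c(1) c(2)[of 0] c(3)[of 0] by linarith
  have M: "M > 0" using m mM by linarith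
  \<comment> \<open>the second entry is \<open>1 - c2 * M / (1 + c2 * M)\<close>, the distance of the largest slope from 1\<close>
  define d where "d = min (c1 * m / (1 + c1 * m)) (1 / (1 + c2 * M))"
  have d0: "0 < d" using c(1) c2 m M by (auto simp: d_def intro!: divide_pos_pos add_pos_pos)
  have d1: "d \<le> 1"
    using c2 M by (auto simp: d_def min_le_iff_disj divide_simps intro!: add_pos_pos disjI2)
  let ?q = "1 - d\<^sup>2"
  have q: "0 \<le> ?q" "?q < 1" using d0 d1 by (auto simp: power_le_one)
  \<comment> \<open>each logarithmic difference is at most \<open>ln M - ln m\<close>; the slope needs twice as much\<close>
  define W where "W = 2 * (ln M - ln m)"
  define \<rho> where "\<rho> = (\<lambda>n. M * (?q ^ (n div 3) * (2 * W)))"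
  have "filterlim (\<lambda>n::nat. n div 3) at_top sequentially"
    by (rule filterlim_at_top_div_const_nat) simp
  then have "(\<lambda>n. ?q ^ (n div 3)) \<longlonglongrightarrow> 0"
    using q by (intro filterlim_compose[OF LIMSEQ_power_zero]) auto
  then have "\<rho> \<longlonglongrightarrow> 0" unfolding \<rho>_def by (auto intro!: tendsto_mult_right_zero tendsto_mult_left_zero)
  moreover have "\<bar>x n - y n\<bar> \<le> \<rho> n" if x: "orbit_within lam c m M x" and y: "orbit_within lam c m M y"
    for x y n
  proof -
    have b: "m \<le> x j" "x j \<le> M" "m \<le> y j" "y j \<le> M" "0 < x j" "0 < y j" for j
      using x y less_le_trans[OF m] unfolding orbit_within_def by blast+
    define u where "u = (\<lambda>j. ln (x j) - ln (y j))"
    have "\<exists>a. d \<le> a \<and> a \<le> 1 - d \<and> u (j + 2) = u (j + 1) - a * u j" for j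
    proof -
      have cj: "0 < c j" using c(1) c(2)[of j] by linarith
      obtain a where a: "c j * m / (1 + c j * m) \<le> a" "a \<le> c j * M / (1 + c j * M)"
        "ln (1 + c j * x j) - ln (1 + c j * y j) = a * (ln (x j) - ln (y j))"
        using ln_one_plus_mean_value[OF cj m] b by blast
      have p: "0 < 1 + c j * t" if "0 < t" for t using cj that by (auto intro!: add_pos_pos)
      have p1: "0 < 1 + c1 * m" "0 < 1 + c2 * M" using c(1) c2 m M by (auto intro!: add_pos_pos)
      have "c1 * m / (1 + c1 * m) \<le> c j * m / (1 + c j * m)"
        using c(2)[of j] m p[OF m] p1 by (simp add: divide_simps) (simp add: algebra_simps)
      moreover have "c j * M / (1 + c j * M) \<le> 1 - 1 / (1 + c2 * M)"
        using c(3)[of j] M p[OF M] p1 by (simp add: divide_simps) (simp add: algebra_simps)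
      ultimately have "d \<le> a" "a \<le> 1 - d" using a(1,2) by (auto simp: d_def min_def)
      moreover have "u (j + 2) = u (j + 1) - a * u j"
      proof -
        have ln_step: "ln (z (j + 2)) = ln lam + ln (z (j + 1)) - ln (1 + c j * z j)"
          if "orbit_within lam c m M z" "0 < z j" "0 < z (j + 1)" for z
        proof -
          have "z (j + 2) = lam * z (j + 1) / (1 + c j * z j)"
            using that(1) unfolding orbit_within_def by blast
          then show ?thesis using that(2,3) p[of "z j"] lam by (simp add: ln_div ln_mult)
        qed
        show ?thesis
          using ln_step[OF x b(5) b(5)] ln_step[OF y b(6) b(6)] a(3) by (simp add: u_def)
      qed
      ultimately show ?thesis by blast
    qed
    then obtain a where a: "\<And>j. d \<le> a j" "\<And>j. a j \<le> 1 - d" "\<And>j. u (j + 2) = u (j + 1) - a j * u j"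
      by metis
    have ub: "\<bar>u j\<bar> \<le> ln M - ln m" for j
    proof -
      have "ln m \<le> ln (x j)" "ln (x j) \<le> ln M" "ln m \<le> ln (y j)" "ln (y j) \<le> ln M"
        using b[of j] m M by auto
      then show ?thesis by (simp add: u_def abs_le_iff)
    qed
    have "\<bar>u 0\<bar> \<le> W" "\<bar>u 1\<bar> \<le> W" "\<bar>u 1 - u 0\<bar> \<le> W"
      using ub[of 0] ub[of 1] by (simp_all add: W_def abs_le_iff)
    from linear_recurrence_geometric_decay[OF a(3) d0 a(1,2) this, of "n mod 3" "n div 3"]
    have un: "\<bar>u n\<bar> \<le> ?q ^ (n div 3) * (2 * W)" by simp
    have "\<bar>x n - y n\<bar> \<le> M * \<bar>u n\<bar>" unfolding u_def by (rule abs_diff_le_abs_ln_diff) (use b in auto)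
    also have "\<dots> \<le> \<rho> n" unfolding \<rho>_def using un M by (intro mult_left_mono) auto
    finally show ?thesis .
  qed
  ultimately show ?thesis by blast
qed

section \<open>Permanence\<close>

text \<open>One step multiplies by at most \<open>lam\<close>, so the delayed term cannot be much smaller than the
  current one, and the denominator then caps the next term: this gives the upper bound. Given
  the upper bound, one step also divides by a bounded amount at most, so the delayed term is at most
  a constant times the current one. The orbit thus dominates an undelayed Beverton-Holt map,
  which is increasing, and stays above the smallest of the initial terms and
  the fixed point of that map.\<close>

lemma orbit_permanent:
  fixes c x :: "nat \<Rightarrow> real"
  assumes lam: "lam > 1" and c: "0 < c1" "\<And>n. c1 \<le> c n" "\<And>n. c n \<le> c2"
    and rec: "\<And>n. x (n + 2) = lam * x (n + 1) / (1 + c n * x n)"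
    and init: "x 0 > 0" "x 1 > 0"
  shows "\<exists>m>0. \<exists>M. \<forall>n. m \<le> x n \<and> x n \<le> M"
proof -
  have cpos: "0 < c n" for n using c(1) c(2)[of n] by linarith
  have c2: "0 < c2" using cpos[of 0] c(3)[of 0] by linarith
  have "0 < x n \<and> 0 < x (Suc n)" for n
  proof (induction n)
    case (Suc n)
    then show ?case using rec[of n] cpos[of n] lam by (auto intro!: divide_pos_pos add_pos_pos)
  qed (use init in auto)
  then have pos: "0 < x n" for n by blast
  have den: "1 < 1 + c n * x n" for n using pos[of n] cpos[of n] by simp
  have growth: "x (n + 2) \<le> lam * x (n + 1)" for n
    unfolding rec using den[of n] pos[of "n + 1"] lam
    frac_le[of "lam * x (n + 1)" "lam * x (n + 1)" 1 "1 + c n * x n"] by (simp add: less_imp_le)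
  define M where "M = Max {x 0, x 1, x 2, lam\<^sup>2 / c1}"
  have upper: "x n \<le> M" for n
  proof -
    have "n = 0 \<or> n = 1 \<or> n = 2 \<or> n = n - 3 + 3" by linarith
    then consider "n = 0" | "n = 1" | "n = 2" | j where "n = j + 3" by blast
    then show ?thesis
    proof cases
      case (4 j)
      have "x (j + 3) = lam * x (j + 2) / (1 + c (j + 1) * x (j + 1))"
        using rec[of "j + 1"] by (simp add: numeral_3_eq_3)
      also have "\<dots> \<le> lam * (lam * x (j + 1)) / (c1 * x (j + 1))"
      proof (intro frac_le mult_left_mono growth)
        have "c1 * x (j + 1) \<le> c (j + 1) * x (j + 1)"
          using c(2) pos[of "j + 1"] by (intro mult_right_mono) auto
        then show "c1 * x (j + 1) \<le> 1 + c (j + 1) * x (j + 1)" by simp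
      qed (use lam pos[of "j + 1"] c(1) in auto)
      also have "\<dots> = lam\<^sup>2 / c1" using pos[of "j + 1"] by (simp add: power2_eq_square)
      finally show ?thesis unfolding 4 M_def by (simp add: le_max_iff_disj)
    qed (auto simp: M_def)
  qed
  have M0: "M > 0" using upper[of 0] pos[of 0] by linarith
  define D where "D = 1 + c2 * M"
  have D: "D > 0" using c2 M0 by (auto simp: D_def intro!: add_pos_pos)
  have decay: "lam * x (n + 1) \<le> D * x (n + 2)" for n
  proof -
    have "c n * x n \<le> c2 * M" using c(3) upper pos[of n] c2 by (intro mult_mono) (auto simp: less_imp_le)
    then have "(1 + c n * x n) * x (n + 2) \<le> D * x (n + 2)"
      using pos[of "n + 2"] by (intro mult_right_mono) (auto simp: D_def)
    moreover have "(1 + c n * x n) * x (n + 2) = lam * x (n + 1)"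
      unfolding rec using den[of n] by simp
    ultimately show ?thesis by simp
  qed
  \<comment> \<open>the orbit satisfies \<open>x (n + 3) \<ge> lam * x (n + 2) / (1 + e * x (n + 2))\<close>, and the fixed point of
    this comparison map is \<open>(lam - 1) / e\<close>\<close>
  define e where "e = c2 * D / lam"
  have e: "e > 0" using c2 D lam by (simp add: e_def)
  define m where "m = Min {x 0, x 1, x 2, (lam - 1) / e}"
  have m0: "m > 0" using pos e lam by (simp add: m_def)
  have me: "m * e \<le> lam - 1"
  proof -
    have "m \<le> (lam - 1) / e" unfolding m_def by (rule Min_le) auto
    then show ?thesis using e by (simp add: field_simps)
  qed
  have low: "m \<le> x (n + 2)" for n
  proof (induction n)
    case 0
    show ?case by (simp add: m_def numeral_2_eq_2)
  next
    case (Suc n)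
    let ?s = "x (n + 2)"
    have s: "?s > 0" by (rule pos)
    have "c (n + 1) * x (n + 1) \<le> c2 * (D * ?s / lam)"
      using c(3) c2 pos[of "n + 1"] decay[of n] lam
      by (intro mult_mono) (auto simp: field_simps)
    then have "c (n + 1) * x (n + 1) \<le> e * ?s" by (simp add: e_def)
    then have "lam * ?s / (1 + e * ?s) \<le> lam * ?s / (1 + c (n + 1) * x (n + 1))"
      using s lam den[of "n + 1"] by (intro divide_left_mono mult_pos_pos) (auto intro: less_trans[OF zero_less_one])
    also have "\<dots> = x (n + 3)" using rec[of "n + 1"] by (simp add: numeral_3_eq_3)
    finally have "lam * ?s / (1 + e * ?s) \<le> x (n + 3)" .
    moreover have "m \<le> lam * ?s / (1 + e * ?s)"
    proof -
      have "m + m * e * ?s \<le> ?s + (lam - 1) * ?s"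
        using me s Suc by (intro add_mono mult_right_mono) auto
      moreover have "0 < 1 + e * ?s" using e s by (auto intro!: add_pos_pos)
      ultimately show ?thesis by (simp add: pos_le_divide_eq algebra_simps)
    qed
    ultimately show ?case by (simp add: numeral_3_eq_3)
  qed
  have "m \<le> x n" for n
  proof -
    have "n = 0 \<or> n = 1 \<or> n = n - 2 + 2" by linarith
    then consider "n = 0" | "n = 1" | j where "n = j + 2" by blast
    then show ?thesis using low by cases (auto simp: m_def)
  qed
  with m0 upper show ?thesis by blast
qed

section \<open>The periodic solution\<close>

lemma periodic_add_multiple:
  fixes f :: "nat \<Rightarrow> 'a"
  assumes "\<And>n. f n = f (n + k)"
  shows "f (n + k * j) = f n"
proof (induction j)
  case (Suc j)
  have "f (n + k * Suc j) = f (n + k * j + k)" by (simp add: algebra_simps)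
  then show ?case using assms Suc by simp
qed simp

lemma periodic_range_finite:
  fixes f :: "nat \<Rightarrow> 'a"
  assumes "k > 0" "\<And>n. f n = f (n + k)"
  shows "finite (range f)"
proof -
  have "f n = f (n mod k)" for n
    using periodic_add_multiple[of f k "n mod k" "n div k"] assms(2) by simp
  then have "range f \<subseteq> f ` {..<k}" using assms(1) by (metis image_eqI image_subsetI lessThan_iff mod_less_divisor)
  then show ?thesis by (rule finite_subset) simp
qed

text \<open>The index is shifted by one: \<open>BH_sequence lam K n\<close> is the term \<open>x (n - 1)\<close> of the solution with
  \<open>x (-1) = 0\<close> and \<open>x 0 = 1\<close>.\<close>

fun BH_sequence :: "real \<Rightarrow> (nat \<Rightarrow> real) \<Rightarrow> nat \<Rightarrow> real" where
  "BH_sequence lam K 0 = 0"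
| "BH_sequence lam K (Suc 0) = 1"
| "BH_sequence lam K (Suc (Suc n)) =
     lam * BH_sequence lam K (Suc n) / (1 + (lam - 1) * (BH_sequence lam K n / K n))"

lemma delayed_BH_solution_exists: "\<exists>x. delayed_BH_solution lam K x"
proof
  have "nat (int n + 1 + 1) = Suc (Suc n)" "nat (int n + 1) = Suc n" for n by simp_all
  then show "delayed_BH_solution lam K (\<lambda>i. BH_sequence lam K (nat (i + 1)))"
    by (simp add: delayed_BH_solution_def)
qed

theorem corollary6p1:
  fixes k :: nat and lam :: real and K :: "nat \<Rightarrow> real"
  assumes "k > 0" and "lam > 1"
    and "\<And>n. K n > 0" and "\<And>n. K n = K (n + k)"
  shows "\<exists>xs :: int \<Rightarrow> real.
           delayed_BH_solution lam K xs \<and>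
           (\<forall>n\<ge>-1. xs n = xs (n + int k)) \<and>
           (\<forall>x. delayed_BH_solution lam K x \<longrightarrow>
              (\<lambda>n::nat. x (int n) - xs (int n)) \<longlonglongrightarrow> 0)"
proof -
  define c where "c = (\<lambda>n. (lam - 1) / K (n + 1))"
  have per: "c n = c (n + k)" for n using assms(4)[of "n + 1"] by (simp add: c_def add_ac)
  have fin: "finite (range c)" using assms(1) per by (rule periodic_range_finite)
  define c1 where "c1 = Min (range c)"
  define c2 where "c2 = Max (range c)"
  have c: "0 < c1" "\<And>n. c1 \<le> c n" "\<And>n. c n \<le> c2"
    using fin assms(2,3) by (auto simp: c1_def c2_def c_def)
  have lam0: "lam > 0" using assms(2) by linarith
  have rec: "x (int (n + 2)) = lam * x (int (n + 1)) / (1 + c n * x (int n))"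
    if "delayed_BH_solution lam K x" for x n
  proof -
    have "x (int (n + 1) + 1) = lam * x (int (n + 1)) / (1 + (lam - 1) * (x (int (n + 1) - 1) / K (n + 1)))"
      using that unfolding delayed_BH_solution_def by blast
    then show ?thesis by (simp add: c_def add.commute)
  qed
  have permanent: "\<exists>m>0. \<exists>M. orbit_within lam c m M (\<lambda>n. x (int n))"
    if x: "delayed_BH_solution lam K x" for x
  proof -
    have "x 0 > 0" "x (-1) \<ge> 0" "x 1 = lam * x 0 / (1 + (lam - 1) * (x (-1) / K 0))"
      using x unfolding delayed_BH_solution_def by (auto dest!: conjunct2 spec[of _ 0])
    moreover have "0 < 1 + (lam - 1) * (x (-1) / K 0)"
      using assms(2) assms(3)[of 0] \<open>x (-1) \<ge> 0\<close> by (intro add_pos_nonneg) auto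
    ultimately have "x (int 0) > 0" "x (int 1) > 0" using assms(2) by auto
    from orbit_permanent[of lam c1 c c2 "\<lambda>n. x (int n)", OF assms(2) c rec[OF x] this]
    show ?thesis using rec[OF x] unfolding orbit_within_def by blast
  qed
  obtain x where x: "delayed_BH_solution lam K x" using delayed_BH_solution_exists by blast
  obtain m M where m: "m > 0" and orb: "orbit_within lam c m M (\<lambda>n. x (int n))"
    using permanent[OF x] by blast
  obtain \<rho> where \<rho>: "\<rho> \<longlonglongrightarrow> 0"
    "\<And>y z n. orbit_within lam c m M y \<Longrightarrow> orbit_within lam c m M z \<Longrightarrow> \<bar>y n - z n\<bar> \<le> \<rho> n"
    using orbits_merge_uniformly[where c = c and M = M, OF lam0 m c] by blast
  have shift: "orbit_within lam c m M (\<lambda>n. x (int (n + k * j)))" for j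
    unfolding orbit_within_def
  proof
    fix n
    have "c (n + k * j) = c n" by (rule periodic_add_multiple) (rule per)
    then show "m \<le> x (int (n + k * j)) \<and> x (int (n + k * j)) \<le> M \<and>
        x (int (n + 2 + k * j)) = lam * x (int (n + 1 + k * j)) / (1 + c n * x (int (n + k * j)))"
      using orb[unfolded orbit_within_def, rule_format, of "n + k * j"] by (simp add: add_ac)
  qed
  have conv_nat: "convergent (\<lambda>j. x (int (n + k * j)))" for n
  proof (rule Cauchy_convergent, rule CauchyI')
    fix \<epsilon> :: real assume "\<epsilon> > 0"
    then obtain N where N: "\<And>i. i \<ge> N \<Longrightarrow> \<bar>\<rho> i\<bar> < \<epsilon>" using \<rho>(1) by (auto simp: LIMSEQ_iff)
    show "\<exists>N. \<forall>i\<ge>N. \<forall>j>i. dist (x (int (n + k * i))) (x (int (n + k * j))) < \<epsilon>"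
    proof (intro exI allI impI)
      fix i j assume i: "i \<ge> N" and "i < j"
      then have j: "n + k * j = n + k * i + k * (j - i)" by (simp add: algebra_simps)
      have "i \<le> k * i" using assms(1) by simp
      then have "N \<le> n + k * i" using i by linarith
      then show "dist (x (int (n + k * i))) (x (int (n + k * j))) < \<epsilon>"
        using \<rho>(2)[OF orb shift[of "j - i"], of "n + k * i"] N[of "n + k * i"]
        by (simp add: dist_real_def j)
    qed
  qed
  define xs where "xs = (\<lambda>i. lim (\<lambda>j. x (i + int (k * j))))"
  have lim_nat: "(\<lambda>j. x (int n + int (k * j))) \<longlonglongrightarrow> xs (int n)" for n
    using conv_nat[of n] unfolding xs_def convergent_LIMSEQ_iff by simp
  \<comment> \<open>at \<open>i = -1\<close> convergence comes from the index \<open>k - 1\<close> by dropping the first term\<close>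
  have lim_xs: "(\<lambda>j. x (i + int (k * j))) \<longlonglongrightarrow> xs i \<and> xs (i + int k) = xs i" if "i \<ge> -1" for i
  proof -
    have "(\<lambda>j. x (i + int (k * Suc j))) \<longlonglongrightarrow> xs (i + int k)"
      using lim_nat[of "nat (i + int k)"] that assms(1) by (simp add: algebra_simps)
    then have *: "(\<lambda>j. x (i + int (k * j))) \<longlonglongrightarrow> xs (i + int k)"
      by (rule LIMSEQ_imp_Suc)
    then have "lim (\<lambda>j. x (i + int (k * j))) = xs (i + int k)" by (rule limI)
    then have "xs i = xs (i + int k)" by (subst xs_def)
    with * show ?thesis by simp
  qed
  have xs_low: "m \<le> xs (int n)" for n
    using orb lim_nat[of n] unfolding orbit_within_def
    by (intro LIMSEQ_le_const[OF lim_nat]) (metis of_nat_add)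
  have xs_pos: "0 < xs i" if "i \<ge> -1" for i
    using xs_low[of "nat (i + int k)"] lim_xs[OF that] that assms(1) m by simp
  have xs_sol: "delayed_BH_solution lam K xs"
    unfolding delayed_BH_solution_def
  proof (intro conjI allI)
    fix n :: nat
    have "xs (int n - 1) > 0" using xs_pos by simp
    then have den: "1 + (lam - 1) * (xs (int n - 1) / K n) \<noteq> 0"
      using assms(2) assms(3)[of n] by (smt (verit) mult_pos_pos divide_pos_pos)
    have "(\<lambda>j. lam * x (int n + int (k * j)) / (1 + (lam - 1) * (x (int n - 1 + int (k * j)) / K n)))
            \<longlonglongrightarrow> lam * xs (int n) / (1 + (lam - 1) * (xs (int n - 1) / K n))"
      using lim_xs[of "int n - 1"] lim_nat[of n] den assms(3)[of n]
      by (intro tendsto_intros) auto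
    moreover have "lam * x (int n + int (k * j)) / (1 + (lam - 1) * (x (int n - 1 + int (k * j)) / K n))
        = x (int (n + 1) + int (k * j))" for j
    proof -
      have "K (n + k * j) = K n" by (rule periodic_add_multiple) (rule assms(4))
      moreover have "x (int (n + k * j) + 1) = lam * x (int (n + k * j)) /
          (1 + (lam - 1) * (x (int (n + k * j) - 1) / K (n + k * j)))"
        using x unfolding delayed_BH_solution_def by blast
      ultimately show ?thesis by (simp add: add_ac diff_add_eq)
    qed
    ultimately have "xs (int (n + 1)) = lam * xs (int n) / (1 + (lam - 1) * (xs (int n - 1) / K n))"
      using lim_nat[of "n + 1"] LIMSEQ_unique by simp
    then show "xs (int n + 1) = lam * xs (int n) / (1 + (lam - 1) * (xs (int n - 1) / K n))"
      by (simp add: add.commute)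
  qed (use xs_pos[of 0] xs_pos[of "-1"] in auto)
  moreover have "(\<lambda>n::nat. y (int n) - xs (int n)) \<longlonglongrightarrow> 0" if y: "delayed_BH_solution lam K y" for y
  proof -
    obtain m1 M1 m2 M2 where 1: "m1 > 0" "orbit_within lam c m1 M1 (\<lambda>n. y (int n))"
      and 2: "m2 > 0" "orbit_within lam c m2 M2 (\<lambda>n. xs (int n))"
      using permanent[OF y] permanent[OF xs_sol] by blast
    let ?orb = "orbit_within lam c (min m1 m2) (max M1 M2)"
    have "min m1 m2 > 0" using 1(1) 2(1) by simp
    from orbits_merge_uniformly[where c = c and M = "max M1 M2", OF lam0 this c]
    obtain \<sigma> where \<sigma>: "\<sigma> \<longlonglongrightarrow> 0" "\<And>v w n. ?orb v \<Longrightarrow> ?orb w \<Longrightarrow> \<bar>v n - w n\<bar> \<le> \<sigma> n"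
      by blast
    have "?orb (\<lambda>n. y (int n))" "?orb (\<lambda>n. xs (int n))"
      using 1 2 by (auto simp: orbit_within_def min_le_iff_disj le_max_iff_disj)
    then have "\<bar>y (int n) - xs (int n)\<bar> \<le> \<sigma> n" for n by (rule \<sigma>(2))
    with \<sigma>(1) have "(\<lambda>n. \<bar>y (int n) - xs (int n)\<bar>) \<longlonglongrightarrow> 0"
      using tendsto_sandwich[of "\<lambda>_. 0" "\<lambda>n. \<bar>y (int n) - xs (int n)\<bar>" sequentially \<sigma> 0]
      by simp
    then show ?thesis by (rule tendsto_rabs_zero_cancel)
  qed
  ultimately show ?thesis using lim_xs by (intro exI[of _ xs]) auto
qed

end
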